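(* Let $k\ge 2$ be an integer and let $F_k$ be the free group on $k$ generators. Let $n,m \in \mathbb{N}$ and suppose that the only common solution $z\in\mathbb{C}$ of $$\frac{p_n(z)}{e_n} = 1 \quad\text{and}\quad \frac{p_m(z)}{e_m} = 1$$ is $z = 2k$. Then a function $f\colon F_k\to\mathbb{C}$ is harmonic if and only if $\sum_{y \in E_n} f(xy) = e_n f(x)$ and $\sum_{y \in E_m} f(xy) = e_m f(x)$ for all $x \in F_k$.
   Context: $\mathbb{N}$ denotes the positive integers. For $x\in F_k$, $|x|$ is the length of the reduced word representing $x$ in the free generators and their inverses. $E_n=\{x\in F_k : |x|=n\}$ and $e_n=|E_n|$, so $e_0=1$ and $e_n=2k(2k-1)^{n-1}$ for $n\ge1$. Polynomials $p_n$: $p_0(z)=1$, $p_1(z)=z$, $p_2(z)=z^2-2k$, and $p_{n+1}(z)=zp_n(z)-(2k-1)p_{n-1}(z)$ for $n\ge 2$. A function $f\colon F_k\to\mathbb{C}$ is harmonic if $\frac{1}{2k}\sum_{y\in E_1}f(xy)=f(x)$ for all $x\in F_k$. *)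

theory Defs
  imports Complex_Main "HOL-Algebra.Group" "HOL-Computational_Algebra.Polynomial"
begin

text \<open>The letter \<open>(True, i)\<close> is the \<open>i\<close>-th free generator, \<open>(False, i)\<close> its formal inverse.\<close>

type_synonym letter = "bool \<times> nat"

definition inv_letter :: "letter \<Rightarrow> letter" where
  "inv_letter a = (\<not> fst a, snd a)"

fun reduced :: "letter list \<Rightarrow> bool" where
  "reduced [] = True"
| "reduced [a] = True"
| "reduced (a # b # w) = (b \<noteq> inv_letter a \<and> reduced (b # w))"

fun cons_red :: "letter \<Rightarrow> letter list \<Rightarrow> letter list" where
  "cons_red a [] = [a]"
| "cons_red a (b # w) = (if b = inv_letter a then w else a # b # w)"

definition reduce :: "letter list \<Rightarrow> letter list" where
  "reduce w = foldr cons_red w []"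

text \<open>The free group on the \<open>k\<close> generators indexed by \<open>{..<k}\<close>, realised on reduced words.
  The lemmas \<open>group_free_group\<close> and \<open>free_group_universal\<close> below confirm that it is
  a group and has the universal property.\<close>

definition free_group :: "nat \<Rightarrow> letter list monoid" where
  "free_group k =
    \<lparr>carrier = {w. reduced w \<and> set w \<subseteq> UNIV \<times> {..<k}},
     monoid.mult = (\<lambda>x y. reduce (x @ y)),
     monoid.one = []\<rparr>"

definition sphere :: "nat \<Rightarrow> nat \<Rightarrow> letter list set" where
  "sphere k n = {x \<in> carrier (free_group k). length x = n}"

definition sphere_size :: "nat \<Rightarrow> nat \<Rightarrow> nat" where
  "sphere_size k n = card (sphere k n)"

text \<open>Index 2 is an exception to the recurrence: it subtracts \<open>2k\<close> times the polynomial of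
  index 0, not \<open>2k - 1\<close> times.\<close>

fun sphere_poly :: "nat \<Rightarrow> nat \<Rightarrow> complex poly" where
  "sphere_poly k 0 = 1"
| "sphere_poly k (Suc 0) = [:0, 1:]"
| "sphere_poly k (Suc (Suc 0)) = [:0, 1:] ^ 2 - [:2 * of_nat k:]"
| "sphere_poly k (Suc (Suc (Suc n))) =
    [:0, 1:] * sphere_poly k (Suc (Suc n)) - smult (2 * of_nat k - 1) (sphere_poly k (Suc n))"

text \<open>A function on the free group is represented by a function on all lists; only its values
  on the carrier matter here.\<close>

definition harmonic :: "nat \<Rightarrow> (letter list \<Rightarrow> complex) \<Rightarrow> bool" where
  "harmonic k f \<longleftrightarrow>
    (\<forall>x \<in> carrier (free_group k).
      1 / (2 * of_nat k) * (\<Sum>y \<in> sphere k 1. f (x \<otimes>\<^bsub>free_group k\<^esub> y)) = f x)"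

lemma inv_letter_inv_letter [simp]: "inv_letter (inv_letter a) = a"
  by (simp add: inv_letter_def)

lemma inv_letter_eq_iff [simp]: "inv_letter a = inv_letter b \<longleftrightarrow> a = b"
  by (metis inv_letter_inv_letter)

lemma inv_letter_neq [simp]: "inv_letter a \<noteq> a" "a \<noteq> inv_letter a"
  by (auto simp: inv_letter_def prod_eq_iff)

lemma reduced_ConsD: "reduced (a # w) \<Longrightarrow> reduced w"
  by (cases w) auto

lemma reduced_cons_red: "reduced w \<Longrightarrow> reduced (cons_red a w)"
  by (cases w) (auto dest: reduced_ConsD)

lemma cons_red_reduced: "reduced (a # w) \<Longrightarrow> cons_red a w = a # w"
  by (cases w) auto

lemma cons_red_inverse:
  assumes "reduced w" shows "cons_red (inv_letter a) (cons_red a w) = w"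
proof (cases w)
  case (Cons b v)
  then show ?thesis using assms by (cases v) auto
qed simp

lemma set_cons_red: "set (cons_red a w) \<subseteq> insert a (set w)"
  by (cases w) auto

lemma reduced_foldr: "reduced w \<Longrightarrow> reduced (foldr cons_red v w)"
  by (induction v) (auto intro: reduced_cons_red)

lemma set_foldr: "set (foldr cons_red v w) \<subseteq> set v \<union> set w"
  by (induction v) (use set_cons_red in fastforce)+

lemma reduce_reduced: "reduced w \<Longrightarrow> reduce w = w"
proof (induction w)
  case (Cons a w)
  then have "reduce w = w" by (auto dest: reduced_ConsD)
  then show ?case using Cons.prems by (simp add: reduce_def cons_red_reduced)
qed (simp add: reduce_def)

lemma reduce_append: "reduced y \<Longrightarrow> reduce (x @ y) = foldr cons_red x y"
  using reduce_reduced[of y] by (simp add: reduce_def)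

lemma foldr_cons_red:
  assumes "reduced z"
  shows "foldr cons_red (cons_red a w) z = cons_red a (foldr cons_red w z)"
proof (cases w)
  case (Cons b v)
  then show ?thesis
    using cons_red_inverse[of "foldr cons_red v z" "inv_letter a"] reduced_foldr[OF assms] by auto
qed simp

lemma foldr_foldr:
  "reduced z \<Longrightarrow> foldr cons_red (foldr cons_red x y) z = foldr cons_red x (foldr cons_red y z)"
  by (induction x) (auto simp: foldr_cons_red)

lemma reduced_append_single:
  "reduced (w @ [b]) \<longleftrightarrow> reduced w \<and> (w \<noteq> [] \<longrightarrow> b \<noteq> inv_letter (last w))"
  by (induction w rule: reduced.induct) auto

lemma reduced_inverse: "reduced w \<Longrightarrow> reduced (rev (map inv_letter w))"
proof (induction w)
  case (Cons a w)
  then have "reduced (rev (map inv_letter w))" "w \<noteq> [] \<Longrightarrow> hd w \<noteq> inv_letter a"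
    by (auto simp: neq_Nil_conv dest: reduced_ConsD)
  then show ?case
    by (auto simp: reduced_append_single last_rev hd_map)
qed simp

lemma foldr_inverse: "reduced w \<Longrightarrow> foldr cons_red (rev (map inv_letter w)) w = []"
proof (induction w)
  case (Cons a w)
  then show ?case
    using cons_red_inverse[of w a] by (auto dest: reduced_ConsD simp: cons_red_reduced)
qed simp

lemma group_free_group: "group (free_group k)"
proof (rule groupI)
  fix x y assume "x \<in> carrier (free_group k)" "y \<in> carrier (free_group k)"
  then show "x \<otimes>\<^bsub>free_group k\<^esub> y \<in> carrier (free_group k)"
    using set_foldr[of x y] by (auto simp: free_group_def reduce_append reduced_foldr)
next
  show "\<one>\<^bsub>free_group k\<^esub> \<in> carrier (free_group k)" by (simp add: free_group_def)
next
  fix x y z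
  assume "x \<in> carrier (free_group k)" "y \<in> carrier (free_group k)" "z \<in> carrier (free_group k)"
  then show "x \<otimes>\<^bsub>free_group k\<^esub> y \<otimes>\<^bsub>free_group k\<^esub> z =
      x \<otimes>\<^bsub>free_group k\<^esub> (y \<otimes>\<^bsub>free_group k\<^esub> z)"
    by (simp add: free_group_def reduce_append reduced_foldr foldr_foldr)
next
  fix x assume "x \<in> carrier (free_group k)"
  then show "\<one>\<^bsub>free_group k\<^esub> \<otimes>\<^bsub>free_group k\<^esub> x = x"
    by (simp add: free_group_def reduce_reduced)
next
  fix x assume x: "x \<in> carrier (free_group k)"
  show "\<exists>y \<in> carrier (free_group k). y \<otimes>\<^bsub>free_group k\<^esub> x = \<one>\<^bsub>free_group k\<^esub>"
  proof (rule bexI[of _ "rev (map inv_letter x)"])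
    show "rev (map inv_letter x) \<otimes>\<^bsub>free_group k\<^esub> x = \<one>\<^bsub>free_group k\<^esub>"
      using x by (simp add: free_group_def reduce_append foldr_inverse)
    show "rev (map inv_letter x) \<in> carrier (free_group k)"
      using x by (auto simp: free_group_def reduced_inverse inv_letter_def)
  qed
qed

lemma free_group_universal:
  assumes "group G" and g: "\<And>i. i < k \<Longrightarrow> g i \<in> carrier G"
  shows "\<exists>h \<in> hom (free_group k) G. (\<forall>i<k. h [(True, i)] = g i) \<and>
    (\<forall>h' \<in> hom (free_group k) G. (\<forall>i<k. h' [(True, i)] = g i) \<longrightarrow>
      (\<forall>x \<in> carrier (free_group k). h' x = h x))"
proof -
  interpret G: group G by fact
  interpret F: group "free_group k" by (rule group_free_group)
  define L where "L = (UNIV :: bool set) \<times> {..<k}"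
  define v where "v a = (if fst a then g (snd a) else inv\<^bsub>G\<^esub> g (snd a))" for a :: letter
  define h where "h w = foldr (\<lambda>a y. v a \<otimes>\<^bsub>G\<^esub> y) w \<one>\<^bsub>G\<^esub>" for w
  have v: "v a \<in> carrier G" if "a \<in> L" for a
    using that g by (auto simp: v_def L_def)
  have v_inv: "v a \<otimes>\<^bsub>G\<^esub> v (inv_letter a) = \<one>\<^bsub>G\<^esub>" if "a \<in> L" for a
    using that g by (auto simp: v_def L_def inv_letter_def)
  have h: "h w \<in> carrier G" if "set w \<subseteq> L" for w
    using that by (induction w) (auto simp: h_def v)
  have h_cons: "h (cons_red a w) = v a \<otimes>\<^bsub>G\<^esub> h w" if "a \<in> L" "set w \<subseteq> L" for a w
  proof (cases w)
    case (Cons b u)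
    then have "b \<in> L" "set u \<subseteq> L" using that by auto
    have "h (b # u) = v b \<otimes>\<^bsub>G\<^esub> h u" by (simp add: h_def)
    moreover have "v a \<otimes>\<^bsub>G\<^esub> (v (inv_letter a) \<otimes>\<^bsub>G\<^esub> h u) = h u" if "b = inv_letter a"
      using v_inv[OF \<open>a \<in> L\<close>] v[OF \<open>a \<in> L\<close>] v[OF \<open>b \<in> L\<close>] h[OF \<open>set u \<subseteq> L\<close>] that
      by (simp flip: G.m_assoc)
    ultimately show ?thesis using Cons by (auto simp: h_def)
  qed (simp add: h_def)
  have h_foldr: "h (foldr cons_red x y) = h x \<otimes>\<^bsub>G\<^esub> h y" if "set x \<subseteq> L" "set y \<subseteq> L" for x y
    using that
  proof (induction x)
    case Nil
    then show ?case using h[of y] by (simp add: h_def)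
  next
    case (Cons a x)
    then have "a \<in> L" "set x \<subseteq> L" by auto
    moreover have "set (foldr cons_red x y) \<subseteq> L" using set_foldr[of x y] Cons.prems by auto
    moreover have "h (a # x) = v a \<otimes>\<^bsub>G\<^esub> h x" by (simp add: h_def)
    ultimately show ?case using Cons v h by (simp add: h_cons G.m_assoc)
  qed
  have "h \<in> hom (free_group k) G"
    by (rule homI) (use h h_foldr in \<open>auto simp: free_group_def reduce_append L_def\<close>)
  moreover have "h [(True, i)] = g i" if "i < k" for i
    using that g by (simp add: h_def v_def)
  moreover have "h' x = h x"
    if h': "h' \<in> hom (free_group k) G" "\<forall>i<k. h' [(True, i)] = g i" and "x \<in> carrier (free_group k)"
    for h' x
  proof -
    interpret h': group_hom "free_group k" G h'
      by unfold_locales (fact h')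
    have letter: "h' [a] = v a" if "a \<in> L" for a
    proof -
      obtain s i where a: "a = (s, i)" "i < k" using \<open>a \<in> L\<close> by (auto simp: L_def)
      have "h' [(False, i)] = inv\<^bsub>G\<^esub> h' [(True, i)]"
      proof (rule sym, rule G.inv_equality)
        have "[(False, i)] \<otimes>\<^bsub>free_group k\<^esub> [(True, i)] = \<one>\<^bsub>free_group k\<^esub>"
          by (simp add: free_group_def reduce_def inv_letter_def)
        then show "h' [(False, i)] \<otimes>\<^bsub>G\<^esub> h' [(True, i)] = \<one>\<^bsub>G\<^esub>"
          using a h'.hom_one
          by (subst h'.hom_mult[symmetric]) (auto simp: free_group_def)
      qed (use a in \<open>auto intro!: h'.hom_closed simp: free_group_def\<close>)
      then show ?thesis using a h'(2) by (cases s) (auto simp: v_def)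
    qed
    have "reduced x" "set x \<subseteq> L" using that(3) by (auto simp: free_group_def L_def)
    then show ?thesis
    proof (induction x)
      case Nil
      then show ?case using h'.hom_one by (simp add: h_def free_group_def)
    next
      case (Cons a x)
      then have x: "reduced x" "set x \<subseteq> L" "a \<in> L" by (auto dest: reduced_ConsD)
      have "a # x = [a] \<otimes>\<^bsub>free_group k\<^esub> x"
        using Cons.prems by (simp add: free_group_def reduce_reduced)
      then have "h' (a # x) = h' [a] \<otimes>\<^bsub>G\<^esub> h' x"
        using x by (simp only:) (rule h'.hom_mult, auto simp: free_group_def L_def)
      then show ?case using Cons x letter by (simp add: h_def)
    qed
  qed
  ultimately show ?thesis by blast
qed

end

theory Submission
  imports Defs "HOL-Computational_Algebra.Field_as_Ring"
    "HOL-Computational_Algebra.Polynomial_Factorial"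
    "HOL-Computational_Algebra.Fundamental_Theorem_Algebra"
begin

text \<open>
  Let \<open>A\<close> be the operator summing a function over the \<open>2k\<close> neighbours of a vertex. The sum over
  the sphere of radius \<open>n\<close> is \<open>p\<^sub>n(A)\<close>, so the two mean value properties say that \<open>f\<close> is
  annihilated by \<open>p\<^sub>n - e\<^sub>n\<close> and \<open>p\<^sub>m - e\<^sub>m\<close> evaluated at \<open>A\<close>, and harmonicity says that it is
  annihilated by \<open>A - 2k\<close>. The recurrence shows that the derivatives \<open>p\<^sub>n'(2k)\<close> increase with \<open>n\<close>
  from \<open>p\<^sub>1'(2k) = 1\<close>. Hence \<open>2k\<close> is a simple root of \<open>p\<^sub>n - e\<^sub>n\<close>, and as it is the only common
  root of both polynomials, their gcd is \<open>z - 2k\<close>, and Bezout's identity finishes the proof.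
\<close>

definition nbr_sum :: "nat \<Rightarrow> (letter list \<Rightarrow> complex) \<Rightarrow> letter list \<Rightarrow> complex" where
  "nbr_sum k f x = (\<Sum>y \<in> sphere k 1. f (x \<otimes>\<^bsub>free_group k\<^esub> y))"

definition sphere_sum :: "nat \<Rightarrow> nat \<Rightarrow> (letter list \<Rightarrow> complex) \<Rightarrow> letter list \<Rightarrow> complex" where
  "sphere_sum k n f x = (\<Sum>y \<in> sphere k n. f (x \<otimes>\<^bsub>free_group k\<^esub> y))"

text \<open>Horner evaluation of \<open>p\<close> at the operator \<open>nbr_sum k\<close>, applied
  to \<open>f\<close>: each \<open>pCons\<close> costs one neighbour sum, which suits induction on
  polynomials.\<close>

definition nbr_poly :: "nat \<Rightarrow> complex poly \<Rightarrow> (letter list \<Rightarrow> complex) \<Rightarrow> letter list \<Rightarrow> complex" where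
  "nbr_poly k p f = fold_coeffs (\<lambda>a g x. a * f x + nbr_sum k g x) p (\<lambda>_. 0)"

definition letters :: "nat \<Rightarrow> letter set" where
  "letters k = UNIV \<times> {..<k}"

section \<open>Letters, spheres and cancellation\<close>

lemma finite_letters [simp]: "finite (letters k)"
  by (simp add: letters_def)

lemma card_letters: "card (letters k) = 2 * k"
  by (simp add: letters_def card_cartesian_product)

lemma inv_letter_in_letters [simp]: "inv_letter a \<in> letters k \<longleftrightarrow> a \<in> letters k"
  by (cases a) (auto simp: letters_def inv_letter_def)

lemma in_carrier: "x \<in> carrier (free_group k) \<longleftrightarrow> reduced x \<and> set x \<subseteq> letters k"
  by (simp add: free_group_def letters_def)

lemma in_sphere: "x \<in> sphere k n \<longleftrightarrow> reduced x \<and> set x \<subseteq> letters k \<and> length x = n"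
  by (auto simp: sphere_def in_carrier)

lemma finite_sphere: "finite (sphere k n)"
  by (rule finite_subset[OF _ finite_lists_length_eq[of "letters k" n]]) (auto simp: in_sphere)

lemma sphere_0: "sphere k 0 = {[]}"
  by (auto simp: in_sphere)

lemma sphere_1: "sphere k (Suc 0) = (\<lambda>a. [a]) ` letters k"
  by (auto simp: in_sphere length_Suc_conv)

lemma mult_carrier:
  "x \<in> carrier (free_group k) \<Longrightarrow> y \<in> sphere k n \<Longrightarrow> x \<otimes>\<^bsub>free_group k\<^esub> y \<in> carrier (free_group k)"
  using group.is_monoid[OF group_free_group] by (auto simp: sphere_def intro: monoid.m_closed)

lemma single_mult: "reduced y \<Longrightarrow> [a] \<otimes>\<^bsub>free_group k\<^esub> y = cons_red a y"
  by (simp add: free_group_def reduce_append del: append.simps)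

text \<open>Only the head of \<open>w\<close> is excluded as a value of \<open>a\<close>, and
  nothing is excluded for empty \<open>w\<close>. Hence the exceptional coefficient
  \<open>2k\<close> at index 2 of \<open>sphere_poly\<close>.\<close>

lemma card_letters_reduced_Cons:
  assumes "w \<in> sphere k n"
  shows "card {a \<in> letters k. reduced (inv_letter a # w)} = (if n = 0 then 2 * k else 2 * k - 1)"
proof (cases w)
  case Nil
  then show ?thesis using assms by (auto simp: in_sphere card_letters)
next
  case (Cons b v)
  then have "{a \<in> letters k. reduced (inv_letter a # w)} = letters k - {b}"
    using assms by (auto simp: in_sphere)
  then show ?thesis using Cons assms by (auto simp: in_sphere card_letters)
qed

text \<open>The pairs split by whether \<open>a\<close> cancels. Without cancellation
  \<open>a # y\<close> runs once through the sphere of radius \<open>n + 2\<close>; otherwise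
  \<open>y = inv_letter a # w\<close> and \<open>w\<close> remains, once for each letter counted in
  \<open>card_letters_reduced_Cons\<close>.\<close>

lemma sum_cons_red_sphere:
  fixes g :: "letter list \<Rightarrow> complex"
  assumes "k \<ge> 1"
  shows "(\<Sum>a \<in> letters k. \<Sum>y \<in> sphere k (Suc n). g (cons_red a y)) =
    (\<Sum>y \<in> sphere k (Suc (Suc n)). g y) +
    (if n = 0 then 2 * of_nat k else 2 * of_nat k - 1) * (\<Sum>w \<in> sphere k n. g w)"
proof -
  let ?P = "letters k \<times> sphere k (Suc n)"
  let ?G = "{(a, y) \<in> ?P. reduced (a # y)}"
  let ?B = "{(a, y) \<in> ?P. \<not> reduced (a # y)}"
  let ?c = "(if n = 0 then 2 * of_nat k else 2 * of_nat k - 1) :: complex"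
  have fin: "finite ?P" by (simp add: finite_sphere)
  have "(\<Sum>a \<in> letters k. \<Sum>y \<in> sphere k (Suc n). g (cons_red a y)) =
      (\<Sum>(a, y) \<in> ?P. g (cons_red a y))"
    by (simp add: sum.cartesian_product)
  also have "\<dots> = (\<Sum>(a, y) \<in> ?G. g (cons_red a y)) + (\<Sum>(a, y) \<in> ?B. g (cons_red a y))"
    by (subst sum.union_disjoint[symmetric]) (auto intro!: sum.cong finite_subset[OF _ fin])
  also have "(\<Sum>(a, y) \<in> ?G. g (cons_red a y)) = (\<Sum>y \<in> sphere k (Suc (Suc n)). g y)"
    by (rule sum.reindex_bij_witness[where i = "\<lambda>y. (hd y, tl y)" and j = "\<lambda>(a, y). a # y"])
      (auto simp: in_sphere cons_red_reduced length_Suc_conv)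
  also have "(\<Sum>(a, y) \<in> ?B. g (cons_red a y)) =
      (\<Sum>(w, a) \<in> (SIGMA w : sphere k n. {a \<in> letters k. reduced (inv_letter a # w)}). g w)"
    by (rule sum.reindex_bij_witness[where i = "\<lambda>(w, a). (a, inv_letter a # w)"
          and j = "\<lambda>(a, y). (tl y, a)"])
      (auto simp: in_sphere length_Suc_conv dest: reduced_ConsD)
  also have "\<dots> = (\<Sum>w \<in> sphere k n. of_nat (card {a \<in> letters k. reduced (inv_letter a # w)}) * g w)"
    by (subst sum.Sigma[symmetric]) (auto simp: finite_sphere)
  also have "\<dots> = (\<Sum>w \<in> sphere k n. ?c * g w)"
    using assms by (intro sum.cong) (auto simp: card_letters_reduced_Cons of_nat_diff)
  finally show ?thesis by (simp add: sum_distrib_left)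
qed

text \<open>By associativity the step from \<open>x\<close> to a neighbour becomes a letter put in
  front of \<open>y\<close>, so \<open>sum_cons_red_sphere\<close> applies.\<close>

lemma nbr_sum_sphere_sum:
  assumes "k \<ge> 1" "x \<in> carrier (free_group k)"
  shows "nbr_sum k (sphere_sum k (Suc n) f) x = sphere_sum k (Suc (Suc n)) f x +
    (if n = 0 then 2 * of_nat k else 2 * of_nat k - 1) * sphere_sum k n f x"
proof -
  interpret group "free_group k" by (rule group_free_group)
  have "nbr_sum k (sphere_sum k (Suc n) f) x =
      (\<Sum>a \<in> letters k. \<Sum>y \<in> sphere k (Suc n). f ((x \<otimes>\<^bsub>free_group k\<^esub> [a]) \<otimes>\<^bsub>free_group k\<^esub> y))"
    by (simp add: nbr_sum_def sphere_sum_def sphere_1 sum.reindex inj_on_def)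
  also have "\<dots> = (\<Sum>a \<in> letters k. \<Sum>y \<in> sphere k (Suc n). f (x \<otimes>\<^bsub>free_group k\<^esub> cons_red a y))"
  proof (intro sum.cong refl)
    fix a y assume "a \<in> letters k" "y \<in> sphere k (Suc n)"
    then show "f ((x \<otimes>\<^bsub>free_group k\<^esub> [a]) \<otimes>\<^bsub>free_group k\<^esub> y) = f (x \<otimes>\<^bsub>free_group k\<^esub> cons_red a y)"
      using assms by (subst m_assoc) (auto simp: in_carrier in_sphere single_mult)
  qed
  finally show ?thesis
    using sum_cons_red_sphere[OF assms(1), of "\<lambda>y. f (x \<otimes>\<^bsub>free_group k\<^esub> y)" n]
    by (simp add: sphere_sum_def)
qed

section \<open>Polynomials in the neighbour operator\<close>

lemma nbr_sum_cong:
  assumes "\<And>x. x \<in> carrier (free_group k) \<Longrightarrow> f x = g x" "x \<in> carrier (free_group k)"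
  shows "nbr_sum k f x = nbr_sum k g x"
  unfolding nbr_sum_def using assms mult_carrier by (intro sum.cong) auto

lemma nbr_poly_0 [simp]: "nbr_poly k 0 f x = 0"
  by (simp add: nbr_poly_def)

lemma nbr_poly_pCons [simp]: "nbr_poly k (pCons a p) f x = a * f x + nbr_sum k (nbr_poly k p f) x"
  \<comment> \<open>\<open>fold_coeffs\<close> skips a zero coefficient on the zero polynomial; both
    sides are then 0.\<close>
  by (cases "p = 0 \<and> a = 0") (auto simp: nbr_poly_def nbr_sum_def)

lemma nbr_poly_1 [simp]: "nbr_poly k 1 f x = f x"
  by (simp add: one_pCons) (simp add: nbr_sum_def)

lemma nbr_poly_add: "nbr_poly k (p + q) f x = nbr_poly k p f x + nbr_poly k q f x"
  by (induction p q arbitrary: x rule: poly_induct2)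
    (simp_all add: nbr_sum_def sum.distrib algebra_simps)

lemma nbr_poly_smult: "nbr_poly k (smult c p) f x = c * nbr_poly k p f x"
  by (induction p arbitrary: x) (simp_all add: nbr_sum_def sum_distrib_left algebra_simps)

lemma nbr_poly_diff: "nbr_poly k (p - q) f x = nbr_poly k p f x - nbr_poly k q f x"
  using nbr_poly_add[of k "p - q" q f x] by simp

text \<open>Products become compositions, which lets a Bezout identity act on functions.\<close>

lemma nbr_poly_mult: "nbr_poly k (p * q) f x = nbr_poly k p (nbr_poly k q f) x"
proof (induction p arbitrary: x)
  case (pCons a p)
  then show ?case by (simp add: nbr_poly_add nbr_poly_smult nbr_sum_def)
qed simp

text \<open>The mean value properties give vanishing on the carrier only, so this is not just
  linearity: the carrier must be closed under passing to neighbours.\<close>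

lemma nbr_poly_eq_0:
  assumes "\<And>x. x \<in> carrier (free_group k) \<Longrightarrow> f x = 0" "x \<in> carrier (free_group k)"
  shows "nbr_poly k p f x = 0"
  using assms(2)
proof (induction p arbitrary: x)
  case (pCons a p)
  then have "nbr_sum k (nbr_poly k p f) x = nbr_sum k (\<lambda>_. 0) x"
    by (intro nbr_sum_cong) auto
  then show ?case using pCons assms(1) by (simp add: nbr_sum_def)
qed simp

text \<open>Both sides obey the same recurrence, by \<open>nbr_sum_sphere_sum\<close>, including the
  exceptional step at index 2.\<close>

lemma sphere_sum_eq_nbr_poly:
  assumes "k \<ge> 1" "x \<in> carrier (free_group k)"
  shows "sphere_sum k n f x = nbr_poly k (sphere_poly k n) f x"
  using assms
proof (induction k n arbitrary: x rule: sphere_poly.induct)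
  case (1 k)
  then show ?case
    using group.is_monoid[OF group_free_group] monoid.r_one[of "free_group k" x]
    by (simp add: sphere_sum_def sphere_0 free_group_def)
next
  case (2 k)
  have "nbr_poly k [:1:] f = f" by (simp add: nbr_sum_def fun_eq_iff)
  then show ?case by (simp add: sphere_sum_def nbr_sum_def)
next
  case (3 k)
  have "nbr_poly k [:1:] f = f" by (simp add: nbr_sum_def fun_eq_iff)
  moreover have "nbr_poly k [:c:] f x = c * f x" for c by (simp add: nbr_sum_def)
  moreover have "sphere_sum k 1 f = nbr_sum k f" by (simp add: fun_eq_iff sphere_sum_def nbr_sum_def)
  moreover have "sphere_sum k 0 f x = f x"
    using 3 group.is_monoid[OF group_free_group] monoid.r_one[of "free_group k" x]
    by (simp add: sphere_sum_def sphere_0 free_group_def)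
  ultimately show ?case using nbr_sum_sphere_sum[OF 3, of 0 f]
    by (simp add: power2_eq_square nbr_poly_diff nbr_poly_mult del: nbr_poly_pCons)
       (simp add: nbr_sum_def)
next
  case (4 k n)
  have "nbr_poly k ([:0, 1:] * sphere_poly k (Suc (Suc n))) f x =
      nbr_sum k (nbr_poly k (sphere_poly k (Suc (Suc n))) f) x"
    by simp
  also have "\<dots> = nbr_sum k (sphere_sum k (Suc (Suc n)) f) x"
    using 4 by (intro nbr_sum_cong) auto
  finally show ?case using nbr_sum_sphere_sum[OF 4(3,4), of "Suc n" f] 4
    by (simp add: nbr_poly_diff nbr_poly_smult)
qed

section \<open>Eigenfunctions, simple roots and coprimality\<close>

lemma nbr_poly_eigen:
  assumes "\<And>x. x \<in> carrier (free_group k) \<Longrightarrow> nbr_sum k f x = c * f x" "x \<in> carrier (free_group k)"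
  shows "nbr_poly k p f x = poly p c * f x"
  using assms(2)
proof (induction p arbitrary: x)
  case (pCons a p)
  then have "nbr_sum k (nbr_poly k p f) x = nbr_sum k (\<lambda>x. poly p c * f x) x"
    by (intro nbr_sum_cong) auto
  also have "\<dots> = poly p c * nbr_sum k f x" by (simp add: nbr_sum_def sum_distrib_left)
  finally show ?case using pCons assms(1) by (simp add: algebra_simps)
qed simp

lemma harmonic_iff_nbr_sum:
  assumes "k \<ge> 1"
  shows "harmonic k f \<longleftrightarrow> (\<forall>x \<in> carrier (free_group k). nbr_sum k f x = 2 * of_nat k * f x)"
  using assms by (auto simp: harmonic_def nbr_sum_def field_simps)

text \<open>The constant function 1 has eigenvalue \<open>2k\<close>, and its sphere sum at the
  identity counts the sphere.\<close>

lemma poly_sphere_poly: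
  assumes "k \<ge> 1"
  shows "poly (sphere_poly k n) (2 * of_nat k) = of_nat (sphere_size k n)"
proof -
  have "nbr_poly k (sphere_poly k n) (\<lambda>_. 1) [] = poly (sphere_poly k n) (2 * of_nat k) * 1"
    by (rule nbr_poly_eigen)
      (auto simp: nbr_sum_def sphere_1 card_image inj_on_def card_letters in_carrier)
  moreover have "sphere_sum k n (\<lambda>_. 1) [] = nbr_poly k (sphere_poly k n) (\<lambda>_. 1) []"
    using assms by (intro sphere_sum_eq_nbr_poly) (auto simp: in_carrier)
  ultimately show ?thesis by (simp add: sphere_sum_def sphere_size_def)
qed

text \<open>The recurrence has two terms, so the induction carries two consecutive derivatives; real
  witnesses make them comparable.\<close>

lemma pderiv_sphere_poly_pos:
  assumes "k \<ge> 1"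
  shows "\<exists>r s :: real. 0 < r \<and> r \<le> s \<and>
    poly (pderiv (sphere_poly k (Suc n))) (2 * of_nat k) = of_real r \<and>
    poly (pderiv (sphere_poly k (Suc (Suc n)))) (2 * of_nat k) = of_real s"
proof (induction n)
  case 0
  \<comment> \<open>The derivatives of \<open>z\<close> and \<open>z^2 - 2k\<close> at
    \<open>2k\<close>.\<close>
  show ?case
    using assms by (intro exI[of _ 1] exI[of _ "4 * real k"])
      (auto simp: pderiv_pCons pderiv_diff pderiv_mult power2_eq_square)
next
  case (Suc n)
  then obtain r s :: real where rs: "0 < r" "r \<le> s"
    "poly (pderiv (sphere_poly k (Suc n))) (2 * of_nat k) = of_real r"
    "poly (pderiv (sphere_poly k (Suc (Suc n)))) (2 * of_nat k) = of_real s"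
    by blast
  \<comment> \<open>The differentiated recurrence at \<open>2k\<close>; the sphere size is the
    undifferentiated value there. So \<open>t - s\<close> is that size plus
    \<open>(2k - 1)(s - r)\<close>.\<close>
  define t where "t = real (sphere_size k (Suc (Suc n))) + 2 * real k * s - (2 * real k - 1) * r"
  have "poly (pderiv (sphere_poly k (Suc (Suc (Suc n))))) (2 * of_nat k) = of_real t"
    using rs assms
    by (simp add: pderiv_diff pderiv_smult pderiv_mult pderiv_pCons poly_sphere_poly t_def
        del: sphere_poly.simps(3))
  moreover have "(2 * real k - 1) * (s - r) \<ge> 0"
    using rs assms by (intro mult_nonneg_nonneg) auto
  then have "s \<le> t" by (simp add: t_def algebra_simps)
  ultimately show ?case using rs by (intro exI[of _ s] exI[of _ t]) auto
qed

text \<open>A root of a common divisor would be a common root, so by the fundamental theorem of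
  algebra such a divisor is a nonzero constant.\<close>

lemma coprime_poly_complex:
  fixes p q :: "complex poly"
  assumes "p \<noteq> 0" and "\<And>z. poly p z = 0 \<Longrightarrow> poly q z \<noteq> 0"
  shows "coprime p q"
proof (rule coprimeI)
  fix d assume d: "d dvd p" "d dvd q"
  then have "poly d z \<noteq> 0" for z
    using assms(2)[of z] by (auto simp: dvd_def)
  then show "is_unit d"
    by (metis fundamental_theorem_of_algebra constant_degree is_unit_iff_degree poly_0)
qed

theorem theorem3p3:
  fixes k n m :: nat and f :: "letter list \<Rightarrow> complex"
  assumes "k \<ge> 2" and "n \<ge> 1" and "m \<ge> 1"
    and "\<forall>z :: complex.
      poly (sphere_poly k n) z / of_nat (sphere_size k n) = 1 \<and>
      poly (sphere_poly k m) z / of_nat (sphere_size k m) = 1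
      \<longleftrightarrow> z = 2 * of_nat k"
  shows "harmonic k f \<longleftrightarrow>
    (\<forall>x \<in> carrier (free_group k).
      (\<Sum>y \<in> sphere k n. f (x \<otimes>\<^bsub>free_group k\<^esub> y)) = of_nat (sphere_size k n) * f x \<and>
      (\<Sum>y \<in> sphere k m. f (x \<otimes>\<^bsub>free_group k\<^esub> y)) = of_nat (sphere_size k m) * f x)"
proof -
  have k: "k \<ge> 1" using assms(1) by simp
  let ?c = "2 * of_nat k :: complex"
  define P where "P i = sphere_poly k i - [:of_nat (sphere_size k i):]" for i
  \<comment> \<open>Division by zero yields 0, so a quotient equal to 1 at \<open>2k\<close> forces
    nonzero sizes.\<close>
  have size_nz: "sphere_size k n \<noteq> 0" "sphere_size k m \<noteq> 0"
    using assms(4)[rule_format, of ?c] by (auto intro!: notI)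
  have common: "z = ?c" if "poly (P n) z = 0" "poly (P m) z = 0" for z
    using that assms(4)[rule_format, of z] size_nz by (simp add: P_def)
  have "poly (P i) ?c = 0" for i
    using poly_sphere_poly[OF k, of i] by (simp add: P_def)
  then have "[:- ?c, 1:] dvd P i" for i
    by (simp add: poly_eq_0_iff_dvd)
  then obtain Q where Q: "P i = [:- ?c, 1:] * Q i" for i
    unfolding dvd_def by metis
  \<comment> \<open>In the product rule at \<open>2k\<close> only the term with the derivative of
    \<open>z - 2k\<close> survives.\<close>
  have "poly (Q n) ?c = poly (pderiv (P n)) ?c"
    by (simp add: Q pderiv_mult pderiv_pCons del: mult_pCons_left)
  also have "pderiv (P n) = pderiv (sphere_poly k n)"
    by (simp add: P_def pderiv_diff pderiv_pCons)
  also have "poly (pderiv (sphere_poly k n)) ?c \<noteq> 0"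
    using pderiv_sphere_poly_pos[OF k, of "n - 1"] assms(2) by auto
  finally have simple: "poly (Q n) ?c \<noteq> 0" .
  \<comment> \<open>A common root of the cofactors would be \<open>2k\<close>, which
    \<open>simple\<close> rules out.\<close>
  have "coprime (Q n) (Q m)"
  proof (rule coprime_poly_complex)
    show "Q n \<noteq> 0" using simple by auto
    show "poly (Q m) z \<noteq> 0" if "poly (Q n) z = 0" for z
    proof
      assume "poly (Q m) z = 0"
      then have "z = ?c" by (intro common) (simp_all only: Q poly_mult that mult_zero_right)
      then show False using that simple by simp
    qed
  qed
  then have "gcd (Q n) (Q m) = 1" by (rule coprime_imp_gcd_eq_1)
  then obtain u v where uv: "u * Q n + v * Q m = 1"
    using bezout_coefficients_fst_snd[of "Q n" "Q m"] by metis
  have "u * P n + v * P m = [:- ?c, 1:] * (u * Q n + v * Q m)"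
    unfolding Q by (simp only: distrib_left mult.left_commute)
  then have bezout: "[:- ?c, 1:] = u * P n + v * P m"
    unfolding uv by simp
  have linear: "nbr_poly k [:- ?c, 1:] f x = nbr_sum k f x - ?c * f x" for x
  proof -
    have "nbr_poly k [:1:] f = f" by (simp add: nbr_sum_def fun_eq_iff)
    then show ?thesis by (subst nbr_poly_pCons) simp
  qed
  have P: "nbr_poly k (P i) f x = sphere_sum k i f x - of_nat (sphere_size k i) * f x"
    if "x \<in> carrier (free_group k)" for i x
    using that k by (simp add: P_def nbr_poly_diff sphere_sum_eq_nbr_poly) (simp add: nbr_sum_def)
  show ?thesis
    unfolding harmonic_iff_nbr_sum[OF k] sphere_sum_def[symmetric]
  proof (intro iffI ballI)
    fix x assume "\<forall>x \<in> carrier (free_group k). nbr_sum k f x = ?c * f x"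
      and x: "x \<in> carrier (free_group k)"
    then have "nbr_poly k (sphere_poly k i) f x = poly (sphere_poly k i) ?c * f x" for i
      by (intro nbr_poly_eigen) auto
    then have "sphere_sum k i f x = of_nat (sphere_size k i) * f x" for i
      unfolding sphere_sum_eq_nbr_poly[OF k x] poly_sphere_poly[OF k] .
    then show "sphere_sum k n f x = of_nat (sphere_size k n) * f x \<and>
        sphere_sum k m f x = of_nat (sphere_size k m) * f x" by blast
  next
    fix x assume *: "\<forall>x \<in> carrier (free_group k).
        sphere_sum k n f x = of_nat (sphere_size k n) * f x \<and>
        sphere_sum k m f x = of_nat (sphere_size k m) * f x"
      and x: "x \<in> carrier (free_group k)"
    \<comment> \<open>The operators of \<open>u\<close> and \<open>v\<close> are applied to
      functions that vanish on the carrier by \<open>P\<close>.\<close>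
    have "nbr_poly k [:- ?c, 1:] f x = 0"
      unfolding bezout nbr_poly_add nbr_poly_mult using * x by (simp add: nbr_poly_eq_0 P)
    then show "nbr_sum k f x = ?c * f x" by (simp only: linear) simp
  qed
qed

end
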